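(* Let $R>0$ and let $S\subset\mathbb{R}^2$ be a nonempty compact set whose volume function satisfies $$V(r;S)=\mu(S)+L_0 r+\pi r^2,\qquad 0\le r<R,$$ for some constant $L_0$. Let $D_1,\dots,D_n$ be an i.i.d. sample of the distance variable $D=\mathcal{D}(X,S)$, where $X$ is uniformly distributed on $B(S,R)\setminus S$, and let $\bar D=\frac1n\sum_{i=1}^n D_i$. Then the estimator of $L_0$ by the method of moments is $$\tilde L_0=\frac{2\pi R}{3}\,\frac{2R-3\bar D}{2\bar D-R}.$$ This estimator is asymptotically normal: as $n\to\infty$, $$\sqrt n\,(\tilde L_0-L_0)\longrightarrow N\big(0,\sigma^2_{\tilde L_0}\big)\quad\text{in law},$$ where $$\sigma^2_{\tilde L_0}=(L_0+\pi R)^2\left[3\left(1+\frac{L_0}{\pi R}\right)^2-1\right].$$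
   Context: For $x\in\mathbb{R}^2$, $\mathcal{D}(x,S)=\inf_{y\in S}\|x-y\|$ is the Euclidean distance to $S$; $B(S,r)=\{x:\mathcal{D}(x,S)\le r\}$ is the closed $r$-parallel set; $\mu$ is Lebesgue measure on $\mathbb{R}^2$; $V(r;S)=\mu(B(S,r))$ is the volume function of $S$. The quantity $R$ is known and $L_0$ is the unknown parameter. The estimator of $L_0$ by the method of moments is the solution in $L_0$ of the equation $\bar D=\mathbb{E}(D)$, where $\mathbb{E}(D)$ is regarded as a function of $L_0$ (with $R$ fixed). It is defined whenever $\bar D\neq R/2$, which holds almost surely. *)

theory Defs
  imports "HOL-Probability.Probability"
begin

definition parallel_set :: "(real^2) set \<Rightarrow> real \<Rightarrow> (real^2) set" where
  "parallel_set S r = {x. infdist x S \<le> r}"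

definition volume_function :: "(real^2) set \<Rightarrow> real \<Rightarrow> real" where
  "volume_function S r = measure lborel (parallel_set S r)"

text \<open>
  If the volume function of \<open>S\<close> is \<open>\<mu>(S) + L r + \<pi> r\<^sup>2\<close> on \<open>[0,R)\<close>, then
  \<open>P(D \<le> r) = (V(r) - V(0)) / (V(R) - V(0)) = (L r + \<pi> r\<^sup>2) / (L R + \<pi> R\<^sup>2)\<close>;
  the following is the derivative of this in \<open>r\<close>.
\<close>

definition distance_density :: "real \<Rightarrow> real \<Rightarrow> real \<Rightarrow> real" where
  "distance_density R L r = (L + 2 * pi * r) / (L * R + pi * R\<^sup>2)"

text \<open>
  The expectation of \<open>D\<close> as a function of the parameter \<open>L\<close>. The moment equation is considered
  for every real \<open>L\<close> for which the expression makes sense, i.e. \<open>L \<noteq> - \<pi> R\<close>: the solution may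
  well be negative, and then need not be the parameter of any actual set.
\<close>

definition mean_distance :: "real \<Rightarrow> real \<Rightarrow> real" where
  "mean_distance R L = (LBINT r:{0..R}. r * distance_density R L r)"

definition solves_moment_equation :: "real \<Rightarrow> real \<Rightarrow> real \<Rightarrow> bool" where
  "solves_moment_equation R d L \<longleftrightarrow> L + pi * R \<noteq> 0 \<and> d = mean_distance R L"

definition sample_mean :: "(nat \<Rightarrow> 'w \<Rightarrow> real) \<Rightarrow> nat \<Rightarrow> 'w \<Rightarrow> real" where
  "sample_mean D n \<omega> = (\<Sum>i<n. D i \<omega>) / real n"

definition L_tilde :: "real \<Rightarrow> real \<Rightarrow> real" where
  "L_tilde R d = (2 * pi * R / 3) * ((2 * R - 3 * d) / (2 * d - R))"

definition asymptotic_variance :: "real \<Rightarrow> real \<Rightarrow> real" where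
  "asymptotic_variance R L = (L + pi * R)\<^sup>2 * (3 * (1 + L / (pi * R))\<^sup>2 - 1)"

text \<open>The library's \<^const>\<open>normal_density\<close> takes the standard deviation.\<close>

definition normal_law :: "real \<Rightarrow> real \<Rightarrow> real measure" where
  "normal_law m v = density lborel (\<lambda>x. ennreal (normal_density m (sqrt v) x))"

end

(*
  On [0,R) the polynomial volume function is the distribution function of D up to normalisation;
  since the level set {infdist x S = R} is null (S splits into finitely many compact pieces of small
  diameter, and the R-level set of each of them meets every ray from one of its points at most
  once), it remains so at R, and D has density (L0 + 2 pi r) / (L0 R + pi R^2). With
  A = L0 + pi R, its mean is m = R/2 + pi R^2 / (6 A) and its variance is
  R^2/12 - pi^2 R^4 / (36 A^2). The moment equation is a Moebius relation between L + pi R and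
  2 m - R, with the inverse L_tilde, so that the central limit theorem and the delta method give
  the result; the limit variance is (6 A^2 / (pi R^2))^2 Var D.
*)
theory Submission
  imports Defs
begin

section \<open>Null level sets of the distance function\<close>

text \<open>Each ray from \<open>a\<close> meets the level set at most once. If \<open>y\<close> is
  a point of \<open>S\<close> nearest to \<open>a + x\<close>, convexity bounds the distance from
  \<open>a + c *\<^sub>R x\<close> to \<open>y\<close> by a weighted mean of
  \<open>dist a y < r\<close> and \<open>r\<close>, where \<open>c < 1\<close> gives the first a
  positive weight.\<close>

lemma negligible_infdist_level_small:
  fixes S :: "'a::euclidean_space set"
  assumes "closed S" "a \<in> S" "S \<subseteq> ball a r"
  shows "negligible {x. infdist x S = r}"
proof (rule starlike_negligible_strong)
  show "closed {x. infdist x S = r}"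
    by (intro closed_Collect_eq continuous_intros)
next
  fix c :: real and x assume c: "0 \<le> c" "c < 1" and x: "a + x \<in> {x. infdist x S = r}"
  obtain y where y: "y \<in> S" "infdist (a + x) S = dist (a + x) y"
    using infdist_attains_inf[OF \<open>closed S\<close>] assms(2) by blast
  have "dist (a + c *\<^sub>R x) y = norm ((1 - c) *\<^sub>R (a - y) + c *\<^sub>R (a + x - y))"
    by (simp add: dist_norm algebra_simps)
  also have "\<dots> \<le> (1 - c) * dist a y + c * dist (a + x) y"
    using c by (intro norm_triangle_le) (simp add: dist_norm)
  also have "\<dots> < (1 - c) * r + c * r"
    using c assms(3) x y by (intro add_less_le_mono mult_strict_left_mono) auto
  finally have "infdist (a + c *\<^sub>R x) S < r"
    using infdist_le2[OF y(1), of "a + c *\<^sub>R x" "dist (a + c *\<^sub>R x) y"] by (simp add: algebra_simps)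
  then show "a + c *\<^sub>R x \<notin> {x. infdist x S = r}" by simp
qed

text \<open>Compactness cuts \<open>S\<close> into finitely many small pieces. A point at distance
  \<open>r\<close> from \<open>S\<close> has a nearest point in one of them, and is then at distance
  exactly \<open>r\<close> from that piece.\<close>

lemma negligible_infdist_level:
  fixes S :: "'a::euclidean_space set"
  assumes "compact S" "S \<noteq> {}" "0 < r"
  shows "negligible {x. infdist x S = r}"
proof -
  obtain k where k: "finite k" "k \<subseteq> S" "S \<subseteq> (\<Union>x\<in>k. ball x (r / 2))"
    using compactE_image[OF \<open>compact S\<close>, of S "\<lambda>x. ball x (r / 2)"] \<open>0 < r\<close>
    by (metis (no_types, lifting) UN_I centre_in_ball half_gt_zero open_ball subsetI)
  \<comment> \<open>The closed ball keeps the pieces closed, and the radius \<open>r / 2\<close>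
    puts them inside the open ball of radius \<open>r\<close>.\<close>
  define T where "T a = S \<inter> cball a (r / 2)" for a
  have T: "closed (T a)" "a \<in> k \<Longrightarrow> a \<in> T a" "T a \<subseteq> ball a r" "T a \<subseteq> S" for a
    using compact_imp_closed[OF \<open>compact S\<close>] k(2) \<open>0 < r\<close> by (auto simp: T_def)
  have "{x. infdist x S = r} \<subseteq> (\<Union>a\<in>k. {x. infdist x (T a) = r})"
  proof
    fix x assume x: "x \<in> {x. infdist x S = r}"
    obtain y where y: "y \<in> S" "infdist x S = dist x y"
      using infdist_attains_inf[OF compact_imp_closed[OF \<open>compact S\<close>] \<open>S \<noteq> {}\<close>] by blast
    then obtain a where a: "a \<in> k" "y \<in> ball a (r / 2)" using k(3) by blast
    have "infdist x (T a) \<le> r"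
      using a y x by (intro infdist_le2[of y]) (auto simp: T_def)
    moreover have "infdist x S \<le> infdist x (T a)"
      using T(2)[OF a(1)] by (intro infdist_mono T(4)) auto
    ultimately show "x \<in> (\<Union>a\<in>k. {x. infdist x (T a) = r})" using a x by auto
  qed
  moreover have "negligible (\<Union>a\<in>k. {x. infdist x (T a) = r})"
    using k(1) T by (intro negligible_Union) (auto intro!: negligible_infdist_level_small)
  ultimately show ?thesis by (rule negligible_subset[rotated])
qed

section \<open>Weak convergence and the delta method\<close>

text \<open>Dominated convergence, with the constant bound 1, for each bounded continuous test
  function.\<close>

lemma weak_conv_m_distr_pointwise:
  fixes Y :: "nat \<Rightarrow> 'a \<Rightarrow> real"
  assumes "prob_space \<Omega>" and [measurable]: "\<And>n. Y n \<in> borel_measurable \<Omega>" "Z \<in> borel_measurable \<Omega>"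
    and lim: "\<And>x. x \<in> space \<Omega> \<Longrightarrow> (\<lambda>n. Y n x) \<longlonglongrightarrow> Z x"
  shows "weak_conv_m (\<lambda>n. distr \<Omega> borel (Y n)) (distr \<Omega> borel Z)"
proof -
  interpret prob_space \<Omega> by fact
  have rd: "real_distribution (distr \<Omega> borel (Y n))" "real_distribution (distr \<Omega> borel Z)" for n
    by simp_all
  show ?thesis
  proof (rule integral_bdd_continuous_conv_imp_weak_conv[OF rd])
    fix f :: "real \<Rightarrow> real"
    assume f: "\<And>x. isCont f x" "\<And>x. \<bar>f x\<bar> \<le> 1"
    have [measurable]: "f \<in> borel_measurable borel"
      using f(1) by (intro borel_measurable_continuous_onI continuous_at_imp_continuous_on) auto
    have "(\<lambda>n. \<integral>x. f (Y n x) \<partial>\<Omega>) \<longlonglongrightarrow> (\<integral>x. f (Z x) \<partial>\<Omega>)"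
      using f lim by (intro integral_dominated_convergence[where w="\<lambda>_. 1"])
        (auto intro!: AE_I2 isCont_tendsto_compose[of _ f])
    then show "(\<lambda>n. integral\<^sup>L (distr \<Omega> borel (Y n)) f) \<longlonglongrightarrow> integral\<^sup>L (distr \<Omega> borel Z) f"
      by (simp add: integral_distr)
  qed
qed

text \<open>Caratheodory's form of the derivative writes the increment of \<open>g\<close> as
  \<open>h y * (y - \<theta>)\<close> with \<open>h\<close> continuous at \<theta>. Thus no quotient
  by \<open>z n\<close>, which may vanish, is formed, and \<open>a n\<close> cancels as soon as it
  is positive.\<close>

lemma tendsto_scaled_difference:
  fixes g :: "real \<Rightarrow> real"
  assumes "(g has_real_derivative g') (at \<theta>)" "filterlim a at_top sequentially" "z \<longlonglongrightarrow> z0"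
  shows "(\<lambda>n. a n * (g (\<theta> + z n / a n) - g \<theta>)) \<longlonglongrightarrow> g' * z0"
proof -
  obtain h where h: "\<And>y. g y - g \<theta> = h y * (y - \<theta>)" "isCont h \<theta>" "h \<theta> = g'"
    using assms(1) unfolding CARAT_DERIV by blast
  have "(\<lambda>n. \<theta> + z n / a n) \<longlonglongrightarrow> \<theta> + 0"
    using assms(2,3) by (intro tendsto_intros real_tendsto_divide_at_top)
  then have "(\<lambda>n. h (\<theta> + z n / a n) * z n) \<longlonglongrightarrow> g' * z0"
    using h(2,3) assms(3) by (intro tendsto_mult) (auto dest: isCont_tendsto_compose[rotated])
  moreover have "eventually (\<lambda>n. h (\<theta> + z n / a n) * z n = a n * (g (\<theta> + z n / a n) - g \<theta>)) sequentially"
    using filterlim_at_top_dense[THEN iffD1, OF assms(2), rule_format, of 0]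
    by eventually_elim (simp add: h(1))
  ultimately show ?thesis by (rule Lim_transform_eventually)
qed

text \<open>Skorohod's representation replaces the weakly convergent variables by pointwise
  convergent ones with the same laws. For these the limit is that of a scaled difference, and it
  carries back because the conclusion speaks of laws only.\<close>

lemma delta_method:
  fixes T :: "nat \<Rightarrow> 'a \<Rightarrow> real"
  assumes "prob_space M" and T[measurable]: "\<And>n. T n \<in> borel_measurable M"
    and g[measurable]: "g \<in> borel_measurable borel"
    and deriv: "(g has_real_derivative g') (at \<theta>)" and a: "filterlim a at_top sequentially"
    and "real_distribution \<nu>" and conv: "weak_conv_m (\<lambda>n. distr M borel (\<lambda>\<omega>. a n * (T n \<omega> - \<theta>))) \<nu>"
  shows "weak_conv_m (\<lambda>n. distr M borel (\<lambda>\<omega>. a n * (g (T n \<omega>) - g \<theta>))) (distr \<nu> borel (\<lambda>x. g' * x))"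
proof -
  interpret prob_space M by fact
  interpret \<nu>: real_distribution \<nu> by fact
  have rd: "real_distribution (distr M borel (\<lambda>\<omega>. a n * (T n \<omega> - \<theta>)))" for n by simp
  obtain \<Omega> :: "real measure" and Y Z where \<Omega>: "prob_space \<Omega>"
    and Y[measurable]: "\<And>n. Y n \<in> borel_measurable \<Omega>"
    and Y_distr: "\<And>n. distr \<Omega> borel (Y n) = distr M borel (\<lambda>\<omega>. a n * (T n \<omega> - \<theta>))"
    and Z: "Z \<in> measurable \<Omega> lborel" and Z_distr: "distr \<Omega> borel Z = \<nu>"
    and lim: "\<And>x. x \<in> space \<Omega> \<Longrightarrow> (\<lambda>n. Y n x) \<longlonglongrightarrow> Z x"
    using Skorohod[OF rd \<open>real_distribution \<nu>\<close> conv] by blast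
  have Z'[measurable]: "Z \<in> borel_measurable \<Omega>" using Z by simp
  \<comment> \<open>If \<open>a n = 0\<close>, both \<open>f n\<close> and the scaled difference vanish, so no \<open>n\<close> is exceptional.\<close>
  define f where "f n z = a n * (g (\<theta> + z / a n) - g \<theta>)" for n z
  have [measurable]: "f n \<in> borel_measurable borel" for n unfolding f_def by measurable
  have "weak_conv_m (\<lambda>n. distr \<Omega> borel (\<lambda>x. f n (Y n x))) (distr \<Omega> borel (\<lambda>x. g' * Z x))"
    unfolding f_def using lim
    by (intro weak_conv_m_distr_pointwise tendsto_scaled_difference \<Omega> deriv a) (auto simp flip: f_def)
  moreover have "distr \<Omega> borel (\<lambda>x. f n (Y n x)) = distr M borel (\<lambda>\<omega>. a n * (g (T n \<omega>) - g \<theta>))" for n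
  proof -
    have "distr \<Omega> borel (\<lambda>x. f n (Y n x)) = distr (distr \<Omega> borel (Y n)) borel (f n)"
      by (simp add: distr_distr comp_def)
    also have "\<dots> = distr M borel (\<lambda>\<omega>. f n (a n * (T n \<omega> - \<theta>)))"
      unfolding Y_distr by (simp add: distr_distr comp_def)
    also have "(\<lambda>\<omega>. f n (a n * (T n \<omega> - \<theta>))) = (\<lambda>\<omega>. a n * (g (T n \<omega>) - g \<theta>))"
      by (cases "a n = 0") (auto simp: f_def)
    finally show ?thesis .
  qed
  moreover have "distr \<Omega> borel (\<lambda>x. g' * Z x) = distr \<nu> borel (\<lambda>x. g' * x)"
    unfolding Z_distr[symmetric] by (simp add: distr_distr comp_def)
  ultimately show ?thesis by simp
qed

section \<open>Scaled normal laws and sums without atoms\<close>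

text \<open>A negative factor is allowed, since the estimator decreases in the sample mean;
  \<open>sqrt (c\<^sup>2)\<close> is \<open>\<bar>c\<bar>\<close>. For \<open>c = 0\<close> the left
  side would be a point mass and the right side the zero measure.\<close>

lemma distr_std_normal_scale:
  assumes "c \<noteq> 0"
  shows "distr std_normal_distribution borel (\<lambda>x. c * x) = normal_law 0 (c\<^sup>2)"
proof -
  interpret real_distribution std_normal_distribution by (rule real_dist_normal_dist)
  have "distributed std_normal_distribution lborel (\<lambda>x. x) std_normal_density"
    by (simp add: distributed_def distr_id2)
  from normal_density_affine[OF this zero_less_one \<open>c \<noteq> 0\<close>, of 0]
  have "distr std_normal_distribution lborel (\<lambda>x. c * x) = density lborel (normal_density 0 \<bar>c\<bar>)"
    by (simp add: distributed_distr_eq_density)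
  then show ?thesis by (simp add: normal_law_def cong: distr_cong)
qed

text \<open>The law of the sum is a convolution, so the mass at \<open>c\<close> is the integral
  over \<open>y\<close> of the mass that the law of \<open>X\<close> has at \<open>c - y\<close>,
  which is 0. It serves with one observation as \<open>X\<close> and the sum of the others as
  \<open>Y\<close>.\<close>

lemma (in prob_space) AE_add_indep_neq:
  fixes X Y :: "'a \<Rightarrow> real"
  assumes "indep_var borel X borel Y" and null: "\<And>c. emeasure (distr M borel X) {c} = 0"
  shows "AE \<omega> in M. X \<omega> + Y \<omega> \<noteq> c"
proof -
  have [measurable]: "X \<in> borel_measurable M" "Y \<in> borel_measurable M"
    using assms(1) by (auto dest: indep_var_rv1 indep_var_rv2)
  have fin: "finite_measure (distr M borel X)" "finite_measure (distr M borel Y)"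
    by (auto intro!: finite_measure_distr)
  have "distr M borel (\<lambda>\<omega>. X \<omega> + Y \<omega>) = convolution (distr M borel Y) (distr M borel X)"
    using fin by (simp add: sum_indep_random_variable[OF assms(1)] convolution_commutative)
  then have "emeasure (distr M borel (\<lambda>\<omega>. X \<omega> + Y \<omega>)) {c}
      = (\<integral>\<^sup>+y. emeasure (distr M borel X) {a. a + y \<in> {c}} \<partial>distr M borel Y)"
    using fin by (simp add: convolution_emeasure del: insert_iff singleton_iff)
  also have "(\<lambda>y. {a. a + y \<in> {c}}) = (\<lambda>y. {c - y})" by auto
  finally have "emeasure (distr M borel (\<lambda>\<omega>. X \<omega> + Y \<omega>)) {c} = 0" using null by simp
  then have "AE x in distr M borel (\<lambda>\<omega>. X \<omega> + Y \<omega>). x \<noteq> c"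
    by (intro AE_I[where N="{c}"]) auto
  then show ?thesis by (subst (asm) AE_distr_iff) auto
qed

section \<open>Parallel sets\<close>

lemma borel_measurable_infdist[measurable (raw)]:
  fixes X :: "'a \<Rightarrow> 'b::metric_space"
  assumes "X \<in> borel_measurable M"
  shows "(\<lambda>x. infdist (X x) S) \<in> borel_measurable M"
  using assms by (rule measurable_compose)
    (intro borel_measurable_continuous_onI continuous_intros)

lemma parallel_set_sets[measurable]: "parallel_set S r \<in> sets borel"
  unfolding parallel_set_def by (intro borel_closed closed_Collect_le continuous_intros)

lemma parallel_set_0: "closed S \<Longrightarrow> S \<noteq> {} \<Longrightarrow> parallel_set S 0 = S"
  using in_closed_iff_infdist_zero[of S] infdist_nonneg[of _ S]
  by (auto simp: parallel_set_def antisym_conv)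

lemma parallel_set_mono: "r \<le> s \<Longrightarrow> parallel_set S r \<subseteq> parallel_set S s"
  by (auto simp: parallel_set_def)

text \<open>Since \<open>measure\<close> is 0 on sets of infinite measure, comparing and subtracting
  volumes requires finiteness. It holds because the triangle inequality through a nearest point of
  \<open>S\<close> puts the parallel set into a ball.\<close>

lemma fmeasurable_parallel_set:
  assumes "compact S" "S \<noteq> {}"
  shows "parallel_set S r \<in> fmeasurable lborel"
proof -
  obtain a b where ab: "a \<in> S" "\<And>x. x \<in> S \<Longrightarrow> dist a x \<le> b"
    using assms compact_imp_bounded[of S] by (metis all_not_in_conv bounded_any_center)
  have "parallel_set S r \<subseteq> cball a (b + r)"
  proof
    fix x assume x: "x \<in> parallel_set S r"
    obtain y where "y \<in> S" "infdist x S = dist x y"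
      using infdist_attains_inf[OF compact_imp_closed[OF assms(1)] assms(2)] by blast
    then show "x \<in> cball a (b + r)"
      using ab(2)[of y] x dist_triangle[of a x y] by (auto simp: parallel_set_def dist_commute)
  qed
  then have "bounded (parallel_set S r)" using bounded_cball bounded_subset by blast
  then show ?thesis
    by (auto intro!: fmeasurableI emeasure_bounded_finite simp: less_top)
qed

section \<open>The density of the distance and its first two moments\<close>

lemma distance_density_nonneg:
  "0 \<le> L \<Longrightarrow> 0 < R \<Longrightarrow> 0 \<le> r \<Longrightarrow> 0 \<le> distance_density R L r"
  by (auto simp: distance_density_def)

lemma distance_density_antiderivative:
  assumes "L * R + pi * R\<^sup>2 \<noteq> 0"
  shows "((\<lambda>r. (L * r + pi * r\<^sup>2) / (L * R + pi * R\<^sup>2)) has_real_derivative distance_density R L r) (at r)"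
  unfolding distance_density_def
  using assms by (auto intro!: derivative_eq_intros simp: divide_simps)

lemma isCont_distance_density: "isCont (distance_density R L) r"
  unfolding distance_density_def divide_inverse by (intro continuous_intros)

lemma borel_measurable_distance_density[measurable]: "distance_density R L \<in> borel_measurable borel"
  unfolding distance_density_def by measurable

text \<open>The moment equation is posed for every real \<open>L\<close> other than
  \<open>- pi * R\<close>, so the formula must cover negative \<open>L + pi * R\<close> too.
  Substituting \<open>L = A - pi * R\<close> leaves a single term that depends on the
  parameter.\<close>

lemma distance_density_moment_1:
  assumes "R > 0" "L + pi * R \<noteq> 0"
  shows "has_bochner_integral lborel (\<lambda>r. indicator {0..R} r *\<^sub>R (r * distance_density R L r))
    (R / 2 + pi * R\<^sup>2 / (6 * (L + pi * R)))"
proof -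
  define A where "A = L + pi * R"
  have A: "A \<noteq> 0" "L = A - pi * R" "L * R + pi * R\<^sup>2 = A * R"
    using assms by (auto simp: A_def power2_eq_square algebra_simps)
  define F where "F r = (L * r^2 / 2 + 2 * pi * r^3 / 3) / (A * R)" for r
  have "has_bochner_integral lborel (\<lambda>r. indicator {0..R} r *\<^sub>R (r * distance_density R L r)) (F R - F 0)"
  proof (rule has_bochner_integral_FTC_Icc)
    fix r
    have "((\<lambda>r. L * r^2 / 2 + 2 * pi * r^3 / 3) has_real_derivative r * (L + 2 * pi * r)) (at r)"
      by (auto intro!: derivative_eq_intros simp: algebra_simps power2_eq_square power3_eq_cube)
    from DERIV_cdivide[OF this, of "A * R"] have "(F has_real_derivative r * distance_density R L r) (at r)"
      by (simp add: F_def[abs_def] distance_density_def A(3))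
    then show "(F has_vector_derivative r * distance_density R L r) (at r within {0..R})"
      by (simp add: has_real_derivative_iff_has_vector_derivative has_vector_derivative_at_within)
  qed (use assms in \<open>auto intro!: continuous_intros continuous_at_imp_continuous_on isCont_distance_density\<close>)
  also have "F R - F 0 = R / 2 + pi * R\<^sup>2 / (6 * A)"
    unfolding F_def A(2) using A(1) assms(1) by (simp add: field_simps power2_eq_square power3_eq_cube)
  finally show ?thesis by (simp add: A_def)
qed

lemma distance_density_moment_2:
  assumes "R > 0" "L + pi * R \<noteq> 0"
  shows "has_bochner_integral lborel (\<lambda>r. indicator {0..R} r *\<^sub>R (r\<^sup>2 * distance_density R L r))
    (R\<^sup>2 / 3 + pi * R^3 / (6 * (L + pi * R)))"
proof -
  define A where "A = L + pi * R"
  have A: "A \<noteq> 0" "L = A - pi * R" "L * R + pi * R\<^sup>2 = A * R"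
    using assms by (auto simp: A_def power2_eq_square algebra_simps)
  define F where "F r = (L * r^3 / 3 + pi * r^4 / 2) / (A * R)" for r
  have "has_bochner_integral lborel (\<lambda>r. indicator {0..R} r *\<^sub>R (r\<^sup>2 * distance_density R L r)) (F R - F 0)"
  proof (rule has_bochner_integral_FTC_Icc)
    fix r
    have "((\<lambda>r. L * r^3 / 3 + pi * r^4 / 2) has_real_derivative r\<^sup>2 * (L + 2 * pi * r)) (at r)"
      by (auto intro!: derivative_eq_intros simp: algebra_simps power2_eq_square power3_eq_cube)
    from DERIV_cdivide[OF this, of "A * R"] have "(F has_real_derivative r\<^sup>2 * distance_density R L r) (at r)"
      by (simp add: F_def[abs_def] distance_density_def A(3))
    then show "(F has_vector_derivative r\<^sup>2 * distance_density R L r) (at r within {0..R})"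
      by (simp add: has_real_derivative_iff_has_vector_derivative has_vector_derivative_at_within)
  qed (use assms in \<open>auto intro!: continuous_intros continuous_at_imp_continuous_on isCont_distance_density\<close>)
  also have "F R - F 0 = R\<^sup>2 / 3 + pi * R^3 / (6 * A)"
    unfolding F_def A(2) using A(1) assms(1) by (simp add: field_simps power2_eq_square power3_eq_cube power4_eq_xxxx)
  finally show ?thesis by (simp add: A_def)
qed

lemma mean_distance_eq:
  assumes "R > 0" "L + pi * R \<noteq> 0"
  shows "mean_distance R L = R / 2 + pi * R\<^sup>2 / (6 * (L + pi * R))"
  unfolding mean_distance_def set_lebesgue_integral_def
  using distance_density_moment_1[OF assms] by (rule has_bochner_integral_integral_eq)

section \<open>Inverting the moment equation\<close>

lemma L_tilde_eq:
  assumes "d \<noteq> R / 2"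
  shows "L_tilde R d = pi * R\<^sup>2 / (3 * (2 * d - R)) - pi * R"
  using assms by (simp add: L_tilde_def field_simps power2_eq_square)

text \<open>With the closed form of the mean, the equation becomes
  \<open>3 * (2 * d - R) * (L + pi * R) = pi * R\<^sup>2\<close>. The right side is nonzero, so
  either factor determines the other.\<close>

lemma solves_moment_equation_iff:
  assumes "R > 0" "d \<noteq> R / 2"
  shows "solves_moment_equation R d L \<longleftrightarrow> L = L_tilde R d"
proof
  assume "solves_moment_equation R d L"
  then have L: "L + pi * R \<noteq> 0" "d = R / 2 + pi * R\<^sup>2 / (6 * (L + pi * R))"
    by (auto simp: solves_moment_equation_def mean_distance_eq[OF \<open>R > 0\<close>])
  then have "3 * (2 * d - R) = pi * R\<^sup>2 / (L + pi * R)" by (simp add: field_simps)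
  then have "pi * R\<^sup>2 / (3 * (2 * d - R)) = L + pi * R" using L(1) assms(1) by simp
  then show "L = L_tilde R d" using L_tilde_eq[OF assms(2)] by simp
next
  assume "L = L_tilde R d"
  then have L: "L + pi * R = pi * R\<^sup>2 / (3 * (2 * d - R))" using L_tilde_eq[OF assms(2)] by simp
  have d: "2 * d - R \<noteq> 0" using assms(2) by auto
  have "L + pi * R \<noteq> 0" using L d assms(1) by simp
  moreover have "d = R / 2 + pi * R\<^sup>2 / (6 * (L + pi * R))"
    unfolding L using d assms(1) by (simp add: field_simps)
  ultimately show "solves_moment_equation R d L"
    by (simp add: solves_moment_equation_def mean_distance_eq[OF \<open>R > 0\<close>])
qed

lemma L_tilde_has_derivative:
  assumes "d \<noteq> R / 2"
  shows "(L_tilde R has_real_derivative - (2 * pi * R\<^sup>2 / (3 * (2 * d - R)\<^sup>2))) (at d)"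
proof -
  have "((\<lambda>d. (2 * R - 3 * d) / (2 * d - R)) has_real_derivative - R / (2 * d - R)\<^sup>2) (at d)"
    using assms by (auto intro!: derivative_eq_intros simp: power2_eq_square algebra_simps)
  from DERIV_cmult[OF this, of "2 * pi * R / 3"] show ?thesis
    by (simp add: L_tilde_def[abs_def] power2_eq_square mult.assoc)
qed

section \<open>The volume function at the endpoint and the law of the distance\<close>

context
  fixes R L\<^sub>0 :: real and S :: "(real^2) set"
  assumes R_pos: "R > 0" and S: "compact S" "S \<noteq> {}"
    and volume: "\<And>r. 0 \<le> r \<Longrightarrow> r < R \<Longrightarrow>
          volume_function S r = measure lborel S + L\<^sub>0 * r + pi * r\<^sup>2"
begin

text \<open>Parallel sets grow with the radius, whereas a negative slope would make the volume
  decrease just after 0. The sign makes the density nonnegative and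
  \<open>L\<^sub>0 + pi * R\<close> positive.\<close>

lemma slope_nonneg: "0 \<le> L\<^sub>0"
proof (rule ccontr)
  assume "\<not> 0 \<le> L\<^sub>0"
  \<comment> \<open>The first bound keeps \<open>r\<close> below \<open>R\<close>; the second gives
    \<open>pi * r < 4 * r \<le> - L\<^sub>0\<close>.\<close>
  define r where "r = min (R / 2) (- L\<^sub>0 / 4)"
  have r: "0 < r" "r < R" "r \<le> - L\<^sub>0 / 4" using \<open>\<not> 0 \<le> L\<^sub>0\<close> R_pos by (auto simp: r_def)
  have "volume_function S 0 \<le> volume_function S r"
    unfolding volume_function_def using r
    by (intro measure_mono_fmeasurable fmeasurable_parallel_set S parallel_set_mono) auto
  then have "0 \<le> r * (L\<^sub>0 + pi * r)"
    using volume[of 0] volume[of r] r by (simp add: power2_eq_square algebra_simps)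
  then have "0 \<le> L\<^sub>0 + pi * r" using r by (simp add: zero_le_mult_iff)
  moreover have "pi * r < 4 * r" using r pi_less_4 by simp
  ultimately show False using r by simp
qed

text \<open>Continuity of measure from below reaches the open set of points at distance less than
  \<open>R\<close>, and the missing level set is null.\<close>

lemma volume_function_R: "volume_function S R = measure lborel S + L\<^sub>0 * R + pi * R\<^sup>2"
proof -
  \<comment> \<open>The sequence starts at 0 and increases to \<open>R\<close> inside
    \<open>[0, R)\<close>, where the volume formula is assumed.\<close>
  define r where "r n = R - R / (real n + 1)" for n
  have r: "0 \<le> r n" "r n < R" for n using R_pos by (auto simp: r_def field_simps)
  have r_lim: "r \<longlonglongrightarrow> R"
  proof -
    have "(\<lambda>n. R - R * inverse (real (Suc n))) \<longlonglongrightarrow> R - R * 0"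
      by (intro tendsto_intros LIMSEQ_inverse_real_of_nat)
    then show ?thesis by (simp add: r_def[abs_def] divide_inverse add.commute)
  qed
  have r_mono: "r m \<le> r n" if "m \<le> n" for m n
    using that R_pos by (auto simp: r_def intro!: divide_left_mono)
  have UN: "(\<Union>n. parallel_set S (r n)) = {x. infdist x S < R}"
  proof safe
    fix x n assume "x \<in> parallel_set S (r n)"
    then show "infdist x S < R" using r(2)[of n] by (simp add: parallel_set_def)
  next
    fix x assume "infdist x S < R"
    from order_tendstoD(1)[OF r_lim this] obtain n where "infdist x S < r n"
      by (auto simp: eventually_sequentially)
    then show "x \<in> (\<Union>n. parallel_set S (r n))" by (auto simp: parallel_set_def intro: less_imp_le)
  qed
  \<comment> \<open>\<open>negligible\<close> refers to the completed measure; a closed level set is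
    Borel, hence null for \<open>lborel\<close> itself.\<close>
  have "{x. infdist x S = R} \<in> sets borel"
    by (intro borel_closed closed_Collect_eq continuous_intros)
  then have null: "{x. infdist x S = R} \<in> null_sets lborel"
    using negligible_infdist_level[OF S R_pos]
    by (simp add: negligible_iff_null_sets null_sets_completion_iff)
  have "parallel_set S R = {x. infdist x S < R} \<union> {x. infdist x S = R}"
    by (auto simp: parallel_set_def)
  then have meas: "measure lborel (parallel_set S R) = measure lborel {x. infdist x S < R}"
    using null by (simp add: measure_Un_null_set borel_open open_Collect_less continuous_intros)
  have "(\<lambda>n. measure lborel (parallel_set S (r n))) \<longlonglongrightarrow> measure lborel (\<Union>n. parallel_set S (r n))"
  proof (rule Lim_measure_incseq)
    show "incseq (\<lambda>n. parallel_set S (r n))"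
      using r_mono by (auto simp: incseq_def parallel_set_def intro: order_trans)
    have "emeasure lborel (\<Union>n. parallel_set S (r n)) \<le> emeasure lborel (parallel_set S R)"
      using UN by (intro emeasure_mono) (auto simp: parallel_set_def)
    then show "emeasure lborel (\<Union>n. parallel_set S (r n)) \<noteq> \<infinity>"
      using fmeasurableD2[OF fmeasurable_parallel_set[OF S, of R]] by (auto simp: top_unique)
  qed auto
  then have "(\<lambda>n. volume_function S (r n)) \<longlonglongrightarrow> volume_function S R"
    by (simp add: UN meas volume_function_def)
  moreover have "(\<lambda>n. volume_function S (r n)) \<longlonglongrightarrow> measure lborel S + L\<^sub>0 * R + pi * R\<^sup>2"
    unfolding volume[OF r] using r_lim by (intro tendsto_intros)
  ultimately show ?thesis by (rule LIMSEQ_unique)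
qed

text \<open>The endpoint \<open>r = R\<close> is included because it gives the normalising constant
  of the uniform law of \<open>X\<close>.\<close>

lemma emeasure_parallel_shell:
  assumes "0 \<le> r" "r \<le> R"
  shows "emeasure lborel (parallel_set S r - S) = ennreal (L\<^sub>0 * r + pi * r\<^sup>2)"
proof -
  have "S \<subseteq> parallel_set S r"
    using parallel_set_mono[OF assms(1), of S] parallel_set_0 S by (simp add: compact_imp_closed)
  moreover have fm: "parallel_set S r \<in> fmeasurable lborel" "S \<in> fmeasurable lborel"
    using fmeasurable_parallel_set[OF S, of r] fmeasurable_parallel_set[OF S, of 0] S
    by (auto simp: parallel_set_0 compact_imp_closed)
  ultimately have "measure lborel (parallel_set S r - S) = volume_function S r - measure lborel S"
    using fmeasurableD2[OF fm(1)] fmeasurableD[OF fm(1)] fmeasurableD[OF fm(2)]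
    by (subst measure_Diff) (auto simp: volume_function_def)
  also have "\<dots> = L\<^sub>0 * r + pi * r\<^sup>2"
    using assms volume[of r] volume_function_R by (cases "r = R") auto
  finally show ?thesis
    using emeasure_eq_measure2[OF fmeasurable.Diff[OF fm(1), of S]] fm(2) by (simp add: fmeasurableD)
qed

text \<open>Distribution functions are compared: the event that the distance is at most
  \<open>a\<close> has as probability the fraction of the shell that lies in
  \<open>parallel_set S a\<close>.\<close>

lemma distributed_infdist:
  fixes N :: "'v measure"
  assumes "prob_space N" and [measurable]: "X \<in> borel_measurable N"
    and X_uniform: "distr N borel X = uniform_measure lborel (parallel_set S R - S)"
  shows "distributed N lborel (\<lambda>\<xi>. infdist (X \<xi>) S) (\<lambda>r. indicator {0..R} r * distance_density R L\<^sub>0 r)"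
proof -
  interpret prob_space N by fact
  have A: "L\<^sub>0 + pi * R > 0" using slope_nonneg R_pos by (simp add: add_nonneg_pos)
  define V where "V r = L\<^sub>0 * r + pi * r\<^sup>2" for r
  have V_pos: "V R > 0" using A R_pos slope_nonneg by (auto simp: V_def intro!: add_nonneg_pos)
  have V_nonneg: "0 \<le> V r" if "0 \<le> r" for r using that slope_nonneg by (auto simp: V_def)
  \<comment> \<open>The common distribution function; the minimum makes it constantly 1 from
    \<open>R\<close> on.\<close>
  define G where "G r = (if r < 0 then 0 else V (min r R) / V R)" for r
  have S_sets[measurable]: "S \<in> sets borel" using S by (simp add: borel_compact)
  show ?thesis
  proof (rule distributedI_borel_atMost)
    show "AE r in lborel. 0 \<le> indicator {0..R} r * distance_density R L\<^sub>0 r"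
      using slope_nonneg R_pos by (auto simp: indicator_def intro!: distance_density_nonneg)
    fix a :: real
    show "(\<integral>\<^sup>+r. ennreal (indicator {0..R} r * distance_density R L\<^sub>0 r * indicator {..a} r) \<partial>lborel) = ennreal (G a)"
    proof (cases "a < 0")
      case True
      then have "(\<integral>\<^sup>+r. ennreal (indicator {0..R} r * distance_density R L\<^sub>0 r * indicator {..a} r) \<partial>lborel)
         = (\<integral>\<^sup>+r. 0 \<partial>(lborel :: real measure))"
        by (intro nn_integral_cong) (auto simp: indicator_def)
      then show ?thesis using True by (simp add: G_def)
    next
      case False
      have "(\<integral>\<^sup>+r. ennreal (indicator {0..R} r * distance_density R L\<^sub>0 r * indicator {..a} r) \<partial>lborel)
         = (\<integral>\<^sup>+r. ennreal (distance_density R L\<^sub>0 r) * indicator {0..min a R} r \<partial>lborel)"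
        by (intro nn_integral_cong) (auto simp: indicator_def)
      also have "\<dots> = ennreal (V (min a R) / V R - V 0 / V R)"
        using False R_pos slope_nonneg V_pos unfolding V_def
        by (intro nn_integral_FTC_Icc distance_density_antiderivative distance_density_nonneg) auto
      finally show ?thesis using False by (simp add: G_def V_def)
    qed
    have "emeasure N {\<xi> \<in> space N. infdist (X \<xi>) S \<le> a} = emeasure (distr N borel X) (parallel_set S a)"
      by (subst emeasure_distr) (auto simp: parallel_set_def intro!: arg_cong[where f="emeasure N"])
    also have "\<dots> = emeasure lborel ((parallel_set S R - S) \<inter> parallel_set S a) / ennreal (V R)"
      using R_pos by (simp add: X_uniform emeasure_parallel_shell V_def)
    also have "\<dots> = ennreal (G a)"
    proof (cases "a < 0")
      case True
      then have "parallel_set S a = {}"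
        using infdist_nonneg[of _ S] by (auto simp: parallel_set_def not_le intro: less_le_trans)
      then show ?thesis using True by (simp add: G_def)
    next
      case False
      have "(parallel_set S R - S) \<inter> parallel_set S a = parallel_set S (min a R) - S"
        by (auto simp: parallel_set_def)
      then show ?thesis
        using False R_pos V_pos V_nonneg[of "min a R"]
        by (simp add: emeasure_parallel_shell G_def divide_ennreal flip: V_def)
    qed
    finally show "emeasure N {\<xi> \<in> space N. infdist (X \<xi>) S \<le> a} = ennreal (G a)" .
  qed (use assms in \<open>auto intro!: borel_measurable_infdist\<close>)
qed

end

section \<open>Asymptotic normality of the moment estimator\<close>

text \<open>The expectation of the distance is identified with \<open>mean_distance\<close>, which
  justifies the moment equation used for the estimator. \<open>L_tilde\<close> is total: on the null
  event that the sample mean is \<open>R / 2\<close> division by zero gives it the value 0, and for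
  \<open>n = 0\<close> the factor \<open>sqrt 0\<close> makes the scaled error 0.\<close>

theorem theorem1:
  fixes R L\<^sub>0 :: real
    and S :: "(real^2) set"
    and N :: "'v measure" and X :: "'v \<Rightarrow> real^2"
    and M :: "'w measure" and D :: "nat \<Rightarrow> 'w \<Rightarrow> real"
  assumes R_pos: "R > 0"
    and S: "compact S" "S \<noteq> {}"
    and volume: "\<And>r. 0 \<le> r \<Longrightarrow> r < R \<Longrightarrow>
          volume_function S r = measure lborel S + L\<^sub>0 * r + pi * r\<^sup>2"
    and N: "prob_space N"
    and X_measurable: "X \<in> borel_measurable N"
    and X_uniform: "distr N borel X = uniform_measure lborel (parallel_set S R - S)"
    and M: "prob_space M"
    and D_indep: "prob_space.indep_vars M (\<lambda>_. borel) D UNIV"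
    and D_law: "\<And>i. distr M borel (D i) = distr N borel (\<lambda>\<xi>. infdist (X \<xi>) S)"
  shows
    "integrable N (\<lambda>\<xi>. infdist (X \<xi>) S) \<and>
       (LINT \<xi>|N. infdist (X \<xi>) S) = mean_distance R L\<^sub>0 \<and> L\<^sub>0 + pi * R \<noteq> 0
     \<and> (\<forall>n\<ge>1. AE \<omega> in M. sample_mean D n \<omega> \<noteq> R / 2)
     \<and> (\<forall>n\<ge>1. \<forall>\<omega>\<in>space M. sample_mean D n \<omega> \<noteq> R / 2 \<longrightarrow>
          (\<forall>L. solves_moment_equation R (sample_mean D n \<omega>) L \<longleftrightarrow>
               L = L_tilde R (sample_mean D n \<omega>)))
     \<and> weak_conv_m
          (\<lambda>n. distr M borel (\<lambda>\<omega>. sqrt (real n) * (L_tilde R (sample_mean D n \<omega>) - L\<^sub>0)))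
          (normal_law 0 (asymptotic_variance R L\<^sub>0))"
proof -
  interpret N: prob_space N by fact
  interpret M: prob_space M by fact
  define A where "A = L\<^sub>0 + pi * R"
  define f where "f r = indicator {0..R} r * distance_density R L\<^sub>0 r" for r
  have L0: "0 \<le> L\<^sub>0" by (rule slope_nonneg[OF R_pos S volume])
  then have A_pos: "A > 0" using R_pos by (simp add: A_def add_nonneg_pos)
  have A_ge: "pi * R \<le> A" using L0 by (simp add: A_def)
  have A_nz: "L\<^sub>0 + pi * R \<noteq> 0" using A_pos by (simp add: A_def)
  define m where "m = R / 2 + pi * R\<^sup>2 / (6 * A)"
  have m: "mean_distance R L\<^sub>0 = m" using mean_distance_eq[OF R_pos A_nz] by (simp add: m_def A_def)
  have f_nonneg: "0 \<le> f r" for r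
    using distance_density_nonneg[OF L0 R_pos, of r] by (auto simp: f_def indicator_def)
  have N_dist: "distributed N lborel (\<lambda>\<xi>. infdist (X \<xi>) S) f"
    unfolding f_def[abs_def] using distributed_infdist[OF R_pos S volume N X_measurable X_uniform] .
  have D_meas[measurable]: "D i \<in> borel_measurable M" for i
    using D_indep by (simp add: M.indep_vars_def2)
  have law: "distr M borel (D i) = density lborel f" for i
    using D_law distributed_distr_eq_density[OF N_dist] by (simp cong: distr_cong)
  have D_dist: "distributed M lborel (D i) f" for i
    using law[of i] distributed_borel_measurable[OF N_dist] by (simp add: distributed_def cong: distr_cong)

  have moment_1: "has_bochner_integral lborel (\<lambda>r. f r * r) m"
    using distance_density_moment_1[OF R_pos A_nz] by (simp add: f_def m_def A_def mult_ac)
  have moment_2: "has_bochner_integral lborel (\<lambda>r. f r * r\<^sup>2) (R\<^sup>2 / 3 + pi * R^3 / (6 * A))"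
    using distance_density_moment_2[OF R_pos A_nz] by (simp add: f_def A_def mult_ac)
  have int_N: "integrable N (\<lambda>\<xi>. infdist (X \<xi>) S)"
    using distributed_integrable[OF N_dist, of "\<lambda>r. r"] f_nonneg moment_1
    by (auto dest: integrable.intros)
  have mean_N: "(LINT \<xi>|N. infdist (X \<xi>) S) = m"
    using distributed_integral[OF N_dist, of "\<lambda>r. r"] f_nonneg has_bochner_integral_integral_eq[OF moment_1]
    by simp
  have int_D: "integrable M (D i)" for i
    using distributed_integrable[OF D_dist, of "\<lambda>r. r"] f_nonneg moment_1
    by (auto dest: integrable.intros)
  have mean_D: "M.expectation (D i) = m" for i
    using distributed_integral[OF D_dist, of "\<lambda>r. r"] f_nonneg has_bochner_integral_integral_eq[OF moment_1]
    by simp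
  have int_D2: "integrable M (\<lambda>\<omega>. (D i \<omega>)\<^sup>2)" for i
    using distributed_integrable[OF D_dist, of "\<lambda>r. r\<^sup>2"] f_nonneg moment_2
    by (auto dest: integrable.intros)
  have mean_D2: "M.expectation (\<lambda>\<omega>. (D i \<omega>)\<^sup>2) = R\<^sup>2 / 3 + pi * R^3 / (6 * A)" for i
    using distributed_integral[OF D_dist, of "\<lambda>r. r\<^sup>2"] f_nonneg has_bochner_integral_integral_eq[OF moment_2]
    by simp
  \<comment> \<open>This is the second moment minus \<open>m\<^sup>2\<close>; the terms
    \<open>pi * R^3 / (6 * A)\<close> cancel.\<close>
  define v where "v = R\<^sup>2 / 12 - pi\<^sup>2 * R^4 / (36 * A\<^sup>2)"
  have var_D: "M.variance (D i) = v" for i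
    using A_pos by (subst M.variance_eq[OF int_D int_D2])
      (simp only: mean_D mean_D2, simp add: m_def v_def field_simps power2_eq_square power3_eq_cube power4_eq_xxxx)
  \<comment> \<open>The derivative of \<open>L_tilde R\<close> at \<open>m\<close>, where
    \<open>2 * m - R = pi * R\<^sup>2 / (3 * A)\<close>.\<close>
  define c where "c = - (6 * A\<^sup>2 / (pi * R\<^sup>2))"
  have A_sq: "(pi * R)\<^sup>2 \<le> A\<^sup>2" using A_ge R_pos by (intro power_mono) auto
  \<comment> \<open>The central limit theorem divides by the standard deviation. From
    \<open>pi * R \<le> A\<close> the subtracted term of \<open>v\<close> is at most
    \<open>R\<^sup>2 / 36\<close>.\<close>
  have v_pos: "v > 0"
  proof -
    have "pi\<^sup>2 * R^4 = R\<^sup>2 * (pi * R)\<^sup>2" by (simp add: power2_eq_square power4_eq_xxxx)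
    also have "\<dots> \<le> R\<^sup>2 * A\<^sup>2" using A_sq by (intro mult_left_mono) auto
    also have "\<dots> < R\<^sup>2 * A\<^sup>2 * 3" using R_pos A_pos by simp
    finally show ?thesis using A_pos by (simp add: v_def field_simps)
  qed
  define s where "s = sqrt v"
  have s: "s > 0" "s\<^sup>2 = v" using v_pos by (auto simp: s_def)
  have variance: "(s * c)\<^sup>2 = asymptotic_variance R L\<^sub>0"
  proof -
    have q: "1 + L\<^sub>0 / (pi * R) = A / (pi * R)" using R_pos by (simp add: A_def field_simps)
    show ?thesis
      unfolding asymptotic_variance_def q power_mult_distrib s(2) v_def c_def A_def[symmetric]
      using A_pos R_pos by (simp add: field_simps power2_eq_square power4_eq_xxxx)
  qed

  have no_atom: "emeasure (distr M borel (D i)) {x}= 0" for i x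
    using distributed_borel_measurable[OF N_dist]
    by (simp add: law emeasure_density nn_integral_indicator_singleton')
  have AE_ne: "AE \<omega> in M. sample_mean D n \<omega> \<noteq> R / 2" if "n \<ge> 1" for n
  proof -
    \<comment> \<open>Splitting off \<open>D 0\<close> needs \<open>n \<ge> 1\<close>; for
      \<open>n = 1\<close> the other summand is the constant 0.\<close>
    have "M.indep_var borel (D 0) borel (\<lambda>\<omega>. \<Sum>i\<in>{1..<n}. D i \<omega>)"
      by (intro M.indep_vars_sum M.indep_vars_subset[OF D_indep]) auto
    from M.AE_add_indep_neq[OF this no_atom]
    have "AE \<omega> in M. D 0 \<omega> + (\<Sum>i\<in>{1..<n}. D i \<omega>) \<noteq> n * (R / 2)" .
    also have "(\<lambda>\<omega>. D 0 \<omega> + (\<Sum>i\<in>{1..<n}. D i \<omega>)) = (\<lambda>\<omega>. \<Sum>i<n. D i \<omega>)"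
      using that by (simp add: lessThan_atLeast0 sum.atLeast_Suc_lessThan)
    finally show ?thesis using that by (auto simp: sample_mean_def field_simps)
  qed

  \<comment> \<open>With this scale the limit is standard normal. The delta method is then applied
    to \<open>s * L_tilde R d\<close>, whose factor \<open>s\<close> restores \<open>sqrt n\<close>
    and enters the limit as \<open>s * c\<close>.\<close>
  define a where "a n = sqrt (real n) / s" for n
  have a_lim: "filterlim a at_top sequentially"
    unfolding a_def using s(1)
    by (intro filterlim_at_top_mult_tendsto_pos[OF tendsto_const, of "1 / s", simplified]
        filterlim_compose[OF sqrt_at_top filterlim_real_sequentially]) auto
  have "weak_conv_m (\<lambda>n. distr M borel (\<lambda>\<omega>. (\<Sum>i<n. D i \<omega> - m) / sqrt (n * s\<^sup>2))) std_normal_distribution"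
    using s int_D2 var_D law mean_D by (intro M.central_limit_theorem D_indep) auto
  \<comment> \<open>For \<open>n = 0\<close> both sides are 0.\<close>
  moreover have "(\<Sum>i<n. D i \<omega> - m) / sqrt (n * s\<^sup>2) = a n * (sample_mean D n \<omega> - m)" for n \<omega>
    using s(1)
    by (cases "n = 0") (simp_all add: a_def sample_mean_def sum_subtractf real_sqrt_mult field_simps)
  ultimately have clt: "weak_conv_m (\<lambda>n. distr M borel (\<lambda>\<omega>. a n * (sample_mean D n \<omega> - m))) std_normal_distribution"
    by simp

  have "2 * m - R = pi * R\<^sup>2 / (3 * A)" by (simp add: m_def)
  then have m_pos: "2 * m - R > 0" using A_pos R_pos by simp
  \<comment> \<open>The true parameter solves the moment equation at the true mean, and the solution
    is unique.\<close>
  have "L_tilde R m = L\<^sub>0"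
    using solves_moment_equation_iff[OF R_pos, of m L\<^sub>0] m_pos A_nz m
    by (simp add: solves_moment_equation_def)
  moreover have "2 * pi * R\<^sup>2 / (3 * (2 * m - R)\<^sup>2) = - c"
    unfolding \<open>2 * m - R = _\<close> c_def using A_pos R_pos by (simp add: field_simps power2_eq_square)
  moreover have "((\<lambda>d. s * L_tilde R d) has_real_derivative
      s * - (2 * pi * R\<^sup>2 / (3 * (2 * m - R)\<^sup>2))) (at m)"
    using m_pos by (intro DERIV_cmult L_tilde_has_derivative) auto
  ultimately have deriv: "((\<lambda>d. s * L_tilde R d) has_real_derivative s * c) (at m)" "L_tilde R m = L\<^sub>0"
    by simp_all
  have "weak_conv_m (\<lambda>n. distr M borel (\<lambda>\<omega>. a n * (s * L_tilde R (sample_mean D n \<omega>) - s * L_tilde R m)))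
      (distr std_normal_distribution borel (\<lambda>x. s * c * x))"
    by (rule delta_method[OF M _ _ deriv(1) a_lim real_dist_normal_dist clt])
      (auto simp: sample_mean_def[abs_def] L_tilde_def)
  moreover have "a n * (s * x - s * y) = sqrt (real n) * (x - y)" for n x y
    using s(1) by (simp add: a_def field_simps)
  moreover have "distr std_normal_distribution borel (\<lambda>x. s * c * x) = normal_law 0 (asymptotic_variance R L\<^sub>0)"
    using s(1) A_pos R_pos unfolding variance[symmetric] by (intro distr_std_normal_scale) (simp add: c_def)
  ultimately have "weak_conv_m
      (\<lambda>n. distr M borel (\<lambda>\<omega>. sqrt (real n) * (L_tilde R (sample_mean D n \<omega>) - L\<^sub>0)))
      (normal_law 0 (asymptotic_variance R L\<^sub>0))"
    by (simp add: deriv(2))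
  then show ?thesis
    using int_N mean_N m A_nz AE_ne solves_moment_equation_iff[OF R_pos] by simp
qed

end
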